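(* Let $G$ be a finite simple undirected graph of girth at least $5$. Then for each vertex $x \in V(G)$, $b(G-\{x\}) \geq b(G) - 2$.
   Context: The girth of a graph is the length of its shortest cycle. A proper coloring of the vertices of a graph is a b-coloring if every color class contains a vertex adjacent to at least one vertex of every other color class. The b-chromatic number $b(G)$ is the largest integer $k$ such that $G$ admits a b-coloring with $k$ colors. $G-\{x\}$ denotes the graph obtained from $G$ by deleting $x$ and all edges incident to $x$. *)

theory Defs
  imports "Graph_Theory.Arc_Walk" "HOL-Library.Extended_Nat"
begin

text \<open>
  Finite simple undirected graphs are rendered by the locale \<^locale>\<open>graph\<close>: finite, symmetric
  digraphs without loops or parallel arcs, each edge being a pair of opposite arcs.  In this
  encoding going back and forth along one edge is a \<^const>\<open>pre_digraph.cycle\<close> of length 2.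
  The cycles of length at least 3 are exactly the cycles of the undirected graph, whence the
  length restriction below.  The girth of a forest is \<open>\<infinity>\<close>.
\<close>

definition girth :: "('a, 'b) pre_digraph \<Rightarrow> enat" where
  "girth G = Inf {enat (length p) | p. pre_digraph.cycle G p \<and> 3 \<le> length p}"

definition proper_colouring :: "('a, 'b) pre_digraph \<Rightarrow> nat \<Rightarrow> ('a \<Rightarrow> nat) \<Rightarrow> bool" where
  "proper_colouring G k c \<longleftrightarrow>
     (\<forall>v\<in>verts G. c v < k) \<and> (\<forall>u v. u \<rightarrow>\<^bsub>G\<^esub> v \<longrightarrow> c u \<noteq> c v)"

definition b_colouring :: "('a, 'b) pre_digraph \<Rightarrow> nat \<Rightarrow> ('a \<Rightarrow> nat) \<Rightarrow> bool" where
  "b_colouring G k c \<longleftrightarrow>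
     proper_colouring G k c \<and>
     (\<forall>i<k. \<exists>v\<in>verts G. c v = i \<and>
        (\<forall>j<k. j \<noteq> i \<longrightarrow> (\<exists>w\<in>verts G. c w = j \<and> v \<rightarrow>\<^bsub>G\<^esub> w)))"

text \<open>
  For a finite loop-free graph the greatest such number exists: every class of a b-colouring is
  nonempty, so it uses at most \<^term>\<open>card (verts G)\<close> colours, and a proper colouring with the
  fewest colours is a b-colouring.  The graph without vertices has b-chromatic number 0.
\<close>

definition b_chromatic_number :: "('a, 'b) pre_digraph \<Rightarrow> nat" where
  "b_chromatic_number G = (GREATEST k. \<exists>c. b_colouring G k c)"

end

theory Submission
  imports Defs
begin

text \<open>
  Let \<open>q = b(G) - 1\<close> and give the colour of \<open>x\<close> a special role.  In \<open>G - x\<close> every one of the other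
  \<open>q\<close> colours still has a vertex seeing all the other \<open>q - 1\<close> of them.  The special class is
  emptied vertex by vertex, keeping at most one of the \<open>q\<close> classes without such a vertex.  A special
  vertex \<open>y\<close> that misses a colour is simply recoloured.  Otherwise let \<open>M\<close> be the set of colours
  \<open>a\<close> such that no \<open>a\<close>-coloured neighbour of \<open>y\<close> is a b-vertex.  If \<open>M\<close> is empty, the colouring is
  a b-colouring with \<open>q + 1\<close> colours.  If \<open>a \<in> M\<close>, then \<open>y\<close> can take colour \<open>a\<close> after its
  \<open>a\<close>-coloured neighbours have moved to colours they miss, and \<open>y\<close> becomes a b-vertex of class \<open>a\<close>.
  This can only spoil classes in \<open>M\<close>, and two different choices of \<open>a\<close> never spoil the same class,
  since a b-vertex of that class would lie on a 4-cycle with \<open>y\<close>.  By counting, some \<open>a \<in> M\<close>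
  preserves the invariant.  When the special class is empty, the at most one bad class is
  dissolved.
\<close>

section \<open>Counting defects\<close>

text \<open>If every \<open>a\<close> left two elements, the disjoint sets \<open>K a\<close> would
  have total size at least \<open>2 * card M\<close> for empty \<open>U\<close>, and at least
  \<open>card M + 1\<close> for a singleton \<open>U\<close>; but they all fit into
  \<open>M - U\<close>.\<close>

lemma exists_single_defect:
  assumes "finite M" "M \<noteq> {}" "U \<subseteq> M" "card U \<le> 1"
    and sub: "\<And>a. a \<in> M \<Longrightarrow> K a \<subseteq> M - U"
    and disj: "\<And>a a'. a \<in> M \<Longrightarrow> a' \<in> M \<Longrightarrow> a \<noteq> a' \<Longrightarrow> K a \<inter> K a' = {}"
  shows "\<exists>a\<in>M. card ((U - {a}) \<union> K a) \<le> 1"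
proof (rule ccontr)
  assume "\<not> ?thesis"
  then have big: "2 \<le> card ((U - {a}) \<union> K a)" if "a \<in> M" for a
    using that by force
  have finU: "finite U"
    using assms finite_subset by blast
  have lower: "2 \<le> card (U - {a}) + card (K a)" if "a \<in> M" for a
    using big[OF that] card_Un_le[of "U - {a}" "K a"] by linarith
  have finK: "\<forall>a\<in>M. finite (K a)"
    using sub assms(1) by (meson finite_Diff finite_subset)
  have "(\<Sum>a\<in>M. card (K a)) = card (\<Union>a\<in>M. K a)"
    using disj finK assms(1) by (intro card_UN_disjoint[symmetric]) auto
  also have "\<dots> \<le> card (M - U)"
    using sub assms(1) by (intro card_mono) auto
  also have "\<dots> = card M - card U"
    using assms(3) finU by (simp add: card_Diff_subset)
  finally have upper: "(\<Sum>a\<in>M. card (K a)) \<le> card M - card U" .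
  have pos: "card M > 0"
    using assms by (simp add: card_gt_0_iff)
  have "card U = 0 \<or> card U = 1"
    using assms(4) by linarith
  then show False
  proof
    assume "card U = 0"
    then have "U = {}"
      using finU by simp
    then have "(\<Sum>a\<in>M. 2) \<le> (\<Sum>a\<in>M. card (K a))"
      using lower by (intro sum_mono) auto
    with upper pos show False
      by simp
  next
    assume "card U = 1"
    then obtain u where U: "U = {u}"
      by (auto simp: card_1_singleton_iff)
    have "u \<in> M"
      using U assms(3) by auto
    \<comment> \<open>For \<open>a \<noteq> u\<close> the element \<open>u\<close> is one of the
      two, so only one is forced from \<open>K a\<close>; for \<open>u\<close> itself both come from
      \<open>K u\<close>.\<close>
    have "(\<Sum>a\<in>M - {u}. 1) \<le> (\<Sum>a\<in>M - {u}. card (K a))"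
      using lower U by (intro sum_mono) fastforce
    moreover have "2 \<le> card (K u)"
      using lower[OF \<open>u \<in> M\<close>] U by simp
    moreover have "(\<Sum>a\<in>M. card (K a)) = card (K u) + (\<Sum>a\<in>M - {u}. card (K a))"
      using \<open>u \<in> M\<close> assms(1) by (rule sum.remove[rotated])
    moreover have "(\<Sum>a\<in>M - {u}. 1) = card M - 1"
      using \<open>u \<in> M\<close> by simp
    ultimately show False
      using upper pos \<open>card U = 1\<close> by linarith
  qed
qed

section \<open>Colourings with an arbitrary set of colours\<close>

locale finite_sym_rel =
  fixes V :: "'a set" and E :: "'a \<Rightarrow> 'a \<Rightarrow> bool"
  assumes finite_V: "finite V"
    and E_in_V: "E u v \<Longrightarrow> u \<in> V \<and> v \<in> V"
    and E_sym: "E u v \<Longrightarrow> E v u"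
    and E_irrefl: "\<not> E v v"
begin

lemma E_commute: "E u v \<longleftrightarrow> E v u"
  using E_sym by blast

text \<open>An arbitrary set \<open>C\<close> in place of an initial segment allows a colour to be
  dropped without renumbering.\<close>

definition proper :: "nat set \<Rightarrow> ('a \<Rightarrow> nat) \<Rightarrow> bool" where
  "proper C c \<longleftrightarrow> c ` V \<subseteq> C \<and> (\<forall>u v. E u v \<longrightarrow> c u \<noteq> c v)"

text \<open>Since \<open>c v\<close> need not lie in \<open>C\<close>, the notion ignores a special
  colour outside \<open>C\<close>.\<close>

definition b_vertex :: "nat set \<Rightarrow> ('a \<Rightarrow> nat) \<Rightarrow> 'a \<Rightarrow> bool" where
  "b_vertex C c v \<longleftrightarrow> v \<in> V \<and> (\<forall>j\<in>C. j \<noteq> c v \<longrightarrow> (\<exists>w. E v w \<and> c w = j))"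

definition undominated :: "nat set \<Rightarrow> ('a \<Rightarrow> nat) \<Rightarrow> nat set" where
  "undominated C c = {i \<in> C. \<nexists>v. b_vertex C c v \<and> c v = i}"

definition b_col :: "nat set \<Rightarrow> ('a \<Rightarrow> nat) \<Rightarrow> bool" where
  "b_col C c \<longleftrightarrow> finite C \<and> proper C c \<and> undominated C c = {}"

text \<open>Each vertex of class \<open>i\<close> misses some other colour and moves there. The
  class is independent, so the moves do not conflict. A b-vertex of another class can lose only
  neighbours of colour \<open>i\<close>, which is no longer demanded.\<close>

lemma dissolve_class:
  assumes "proper C c" "i \<in> undominated C c"
  shows "\<exists>c'. proper (C - {i}) c' \<and> undominated (C - {i}) c' \<subseteq> undominated C c"
proof -
  have "\<exists>j. j \<in> C \<and> j \<noteq> i \<and> (\<forall>w. E v w \<longrightarrow> c w \<noteq> j)" if "v \<in> V" "c v = i" for v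
    using assms(2) that by (auto simp: undominated_def b_vertex_def)
  then obtain l where l: "\<And>v. v \<in> V \<Longrightarrow> c v = i \<Longrightarrow>
      l v \<in> C \<and> l v \<noteq> i \<and> (\<forall>w. E v w \<longrightarrow> c w \<noteq> l v)"
    by metis
  define c' where "c' v = (if c v = i then l v else c v)" for v
  have "proper (C - {i}) c'"
    unfolding proper_def
  proof (intro conjI allI impI)
    show "c' ` V \<subseteq> C - {i}"
      using l assms(1) by (auto simp: c'_def proper_def)
    fix u v assume "E u v"
    then have "u \<in> V" "v \<in> V" "E v u" "c u \<noteq> c v"
      using E_in_V assms(1) E_commute[of u v] by (auto simp: proper_def)
    then show "c' u \<noteq> c' v"
      using l[of u] l[of v] \<open>E u v\<close> by (auto simp: c'_def)
  qed
  moreover have "b_vertex (C - {i}) c' v" if "b_vertex C c v" "c v \<noteq> i" for v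
    using that by (fastforce simp: b_vertex_def c'_def)
  then have "undominated (C - {i}) c' \<subseteq> undominated C c"
    by (auto simp: undominated_def c'_def)
  ultimately show ?thesis
    by blast
qed

text \<open>Start from an injective colouring and dissolve undominated classes; each round removes
  one colour.\<close>

lemma b_col_exists: "\<exists>C c. b_col C c"
proof -
  have *: "\<exists>C c. b_col C c" if "finite C" "proper C c" for C c
    using that
  proof (induction "card C" arbitrary: C c rule: less_induct)
    case less
    show ?case
    proof (cases "undominated C c = {}")
      case True
      then show ?thesis
        using less.prems unfolding b_col_def by blast
    next
      case False
      then obtain i where i: "i \<in> undominated C c"
        by blast
      then have "i \<in> C"
        by (simp add: undominated_def)
      then have "card (C - {i}) < card C"
        using less.prems(1) by (meson card_Diff1_less)
      then show ?thesis
        using dissolve_class[OF less.prems(2) i] less.hyps less.prems(1) by blast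
    qed
  qed
  obtain c :: "'a \<Rightarrow> nat" where c: "inj_on c V"
    using finite_imp_inj_to_nat_seg[OF finite_V] by blast
  have "proper (c ` V) c"
    using c E_in_V E_irrefl by (fastforce simp: proper_def inj_on_def)
  then show ?thesis
    using * finite_V by blast
qed

section \<open>Emptying the special class\<close>

text \<open>Induction on the size of class \<open>s\<close>. Domination is measured against
  \<open>C\<close> alone, so \<open>s\<close> may disappear freely. The single undominated colour
  allowed accounts for the \<open>+ 1\<close>: it is dissolved at the end.\<close>

lemma b_col_of_special_class:
  assumes C4_free: "\<And>u v w y. E u v \<Longrightarrow> E v w \<Longrightarrow> E w y \<Longrightarrow> E y u \<Longrightarrow> u \<noteq> w \<Longrightarrow> v = y"
    and "finite C" "s \<notin> C" "proper (insert s C) c" "card (undominated C c) \<le> 1"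
  shows "\<exists>C' c'. b_col C' c' \<and> card C \<le> card C' + 1"
  using assms(4,5)
proof (induction "card {v \<in> V. c v = s}" arbitrary: c rule: less_induct)
  case less
  note c_proper = less.prems(1)
  define U where "U = undominated C c"
  have finU: "finite U" "U \<subseteq> C"
    using assms(2) by (auto simp: U_def undominated_def)
  have c_adj: "c u \<noteq> c v" if "E u v" for u v
    using c_proper that by (simp add: proper_def)
  have c_in: "c v \<in> insert s C" if "v \<in> V" for v
    using c_proper that by (auto simp: proper_def)
  show ?case
  proof (cases "\<exists>y\<in>V. c y = s")
    case False
    then have pr: "proper C c"
      using c_proper by (auto simp: proper_def)
    show ?thesis
    proof (cases "U = {}")
      case True
      then show ?thesis
        using pr assms(2) by (intro exI[of _ C] exI[of _ c]) (simp add: b_col_def U_def)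
    next
      case False
      then have "card U = 1"
        using less.prems(2) finU(1) card_0_eq[of U] unfolding U_def[symmetric] by linarith
      then obtain i where i: "U = {i}"
        by (auto simp: card_1_singleton_iff)
      then obtain c' where c': "proper (C - {i}) c'" "undominated (C - {i}) c' \<subseteq> U"
        using dissolve_class[OF pr, of i] by (auto simp: U_def)
      then have "undominated (C - {i}) c' = {}"
        using i by (auto simp: undominated_def)
      then have "b_col (C - {i}) c'"
        using c' assms(2) by (simp add: b_col_def)
      moreover have "card C \<le> card (C - {i}) + 1"
        using diff_card_le_card_Diff[of "{i}" C] by simp
      ultimately show ?thesis
        by blast
    qed
  next
    case True
    then obtain y where y: "y \<in> V" "c y = s"
      by blast
    have decrease: "card {v \<in> V. c' v = s} < card {v \<in> V. c v = s}"
      if "c' y \<noteq> s" "\<And>v. c' v = s \<Longrightarrow> c v = s" for c'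
      using that y finite_V by (intro psubset_card_mono) auto
    show ?thesis
    proof (cases "\<exists>a\<in>C. \<forall>w. E y w \<longrightarrow> c w \<noteq> a")
      case True
      then obtain a where a: "a \<in> C" "\<And>w. E y w \<Longrightarrow> c w \<noteq> a"
        by blast
      define c' where "c' = c(y := a)"
      have "proper (insert s C) c'"
        using c_proper a y E_commute by (auto simp: proper_def c'_def)
      \<comment> \<open>As \<open>y\<close> had colour \<open>s\<close> outside \<open>C\<close>, it
        was no needed neighbour of any such \<open>v\<close>.\<close>
      moreover have "b_vertex C c' v \<and> c' v = c v" if "b_vertex C c v" "c v \<in> C" for v
      proof -
        have "v \<noteq> y"
          using that assms(3) y by auto
        moreover have "\<exists>w. E v w \<and> c' w = j" if j: "j \<in> C" "j \<noteq> c v" for j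
        proof -
          obtain w where "E v w" "c w = j"
            using \<open>b_vertex C c v\<close> j unfolding b_vertex_def by blast
          then show ?thesis
            using j y assms(3) by (intro exI[of _ w]) (auto simp: c'_def)
        qed
        ultimately show ?thesis
          using that by (auto simp: b_vertex_def c'_def)
      qed
      then have "undominated C c' \<subseteq> U"
        by (auto simp: undominated_def U_def)
      then have "card (undominated C c') \<le> 1"
        using less.prems(2) finU(1) card_mono unfolding U_def by (meson le_trans)
      moreover have "card {v \<in> V. c' v = s} < card {v \<in> V. c v = s}"
        using a assms(3) by (intro decrease) (auto simp: c'_def split: if_splits)
      ultimately show ?thesis
        using less.hyps by blast
    next
      case False
      then have y_sees: "\<exists>w. E y w \<and> c w = a" if "a \<in> C" for a
        using that by blast
      define M where "M = {a \<in> C. \<forall>w. E y w \<longrightarrow> c w = a \<longrightarrow> \<not> b_vertex C c w}"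
      have "finite M" "M \<subseteq> C"
        using assms(2) by (auto simp: M_def)
      show ?thesis
      proof (cases "M = {}")
        case True
        \<comment> \<open>\<open>y\<close> sees all of \<open>C\<close>, and the b-vertices among
          its neighbours see \<open>s\<close> at \<open>y\<close>.\<close>
        have "\<exists>v. b_vertex (insert s C) c v \<and> c v = i" if i: "i \<in> insert s C" for i
        proof (cases "i = s")
          case True
          then show ?thesis
            using y y_sees by (intro exI[of _ y]) (auto simp: b_vertex_def)
        next
          case False
          then obtain w where "E y w" "c w = i" "b_vertex C c w"
            using \<open>M = {}\<close> i by (auto simp: M_def)
          then show ?thesis
            using y E_commute[of y w] by (intro exI[of _ w]) (auto simp: b_vertex_def)
        qed
        then have "b_col (insert s C) c"
          using c_proper assms(2) by (auto simp: b_col_def undominated_def)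
        moreover have "card C \<le> card (insert s C) + 1"
          using assms(2,3) by simp
        ultimately show ?thesis
          by blast
      next
        case False
        have "\<exists>l. l \<in> C \<and> l \<noteq> c z \<and> (\<forall>w. E z w \<longrightarrow> c w \<noteq> l)" if "E y z" "c z \<in> M" for z
          using that E_in_V by (fastforce simp: M_def b_vertex_def)
        then obtain l where l: "\<And>z. E y z \<Longrightarrow> c z \<in> M \<Longrightarrow>
            l z \<in> C \<and> l z \<noteq> c z \<and> (\<forall>w. E z w \<longrightarrow> c w \<noteq> l z)"
          by metis
        define r where "r a v = (if v = y then a else if E y v \<and> c v = a then l v else c v)" for a v
        define K where "K a = undominated C (r a) - U" for a
        have r_proper: "proper (insert s C) (r a)" if "a \<in> M" for a
          unfolding proper_def
        proof (intro conjI allI impI)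
          show "r a ` V \<subseteq> insert s C"
            using c_in l that \<open>M \<subseteq> C\<close> by (auto simp: r_def)
          \<comment> \<open>All neighbours of \<open>y\<close> coloured \<open>a\<close> move away,
            to colours other than \<open>a\<close> that none of their neighbours had. No two of them
            are adjacent.\<close>
          fix u v assume "E u v"
          then have "E v u" "c u \<noteq> c v"
            using E_sym c_adj by blast+
          then show "r a u \<noteq> r a v"
            using l[of u] l[of v] that \<open>E u v\<close> unfolding r_def by (smt (verit))
        qed
        have y_dom: "b_vertex C (r a) y \<and> r a y = a" if "a \<in> M" for a
        proof -
          have "\<exists>w. E y w \<and> r a w = j" if j: "j \<in> C" "j \<noteq> a" for j
          proof -
            obtain w where "E y w" "c w = j"
              using y_sees j by blast
            moreover have "w \<noteq> y"
              using c_adj calculation by blast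
            ultimately show ?thesis
              using j by (intro exI[of _ w]) (auto simp: r_def)
          qed
          then show ?thesis
            using y by (auto simp: b_vertex_def r_def)
        qed
        \<comment> \<open>Only \<open>y\<close> and its neighbours coloured \<open>a\<close> change,
          so \<open>v\<close> can lose only colour \<open>a\<close>, and only through a common
          neighbour with \<open>y\<close>. If \<open>v\<close> is adjacent to \<open>y\<close>, then
          \<open>y\<close> supplies \<open>a\<close> instead.\<close>
        have keeps: "b_vertex C (r a) v \<and> r a v = c v"
          if "a \<in> M" "b_vertex C c v" "c v \<in> C"
            and ok: "c v = a \<or> E v y \<or> \<not> (\<exists>z. E v z \<and> E y z \<and> c z = a)" for a v
        proof -
          have "v \<noteq> y"
            using that y assms(3) by auto
          \<comment> \<open>A b-vertex is never among the vertices that move, because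
            \<open>a \<in> M\<close>.\<close>
          moreover have "\<not> (E y v \<and> c v = a)"
            using that by (auto simp: M_def)
          ultimately have rv: "r a v = c v"
            by (auto simp: r_def)
          have "\<exists>w. E v w \<and> r a w = j" if j: "j \<in> C" "j \<noteq> c v" for j
          proof -
            obtain w where w: "E v w" "c w = j"
              using \<open>b_vertex C c v\<close> j unfolding b_vertex_def by blast
            then have "w \<noteq> y"
              using y j assms(3) by auto
            show ?thesis
            proof (cases "E y w \<and> j = a")
              case True
              then have "E v y"
                using ok w j by metis
              then show ?thesis
                using True by (intro exI[of _ y]) (auto simp: r_def)
            next
              case False
              then show ?thesis
                using w \<open>w \<noteq> y\<close> by (intro exI[of _ w]) (auto simp: r_def)
            qed
          qed
          then show ?thesis
            using rv \<open>b_vertex C c v\<close> by (auto simp: b_vertex_def)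
        qed
        have spoiled: "\<exists>z. E v z \<and> E y z \<and> c z = a"
          if "a \<in> M" "b \<in> K a" "b_vertex C c v" "c v = b" for a b v
        proof (rule ccontr)
          assume "\<not> ?thesis"
          then have "b_vertex C (r a) v \<and> r a v = c v"
            using that by (intro keeps) (auto simp: K_def undominated_def)
          then show False
            using that by (auto simp: K_def undominated_def)
        qed
        \<comment> \<open>A b-vertex adjacent to \<open>y\<close> survives the recolouring, so a
          spoiled colour has none among the neighbours of \<open>y\<close>.\<close>
        have K_M: "K a \<subseteq> M - U" if "a \<in> M" for a
        proof
          fix b assume b: "b \<in> K a"
          then have "b \<in> C" "b \<notin> U"
            by (auto simp: K_def undominated_def)
          moreover have "\<not> b_vertex C c w" if "E y w" "c w = b" for w
          proof
            assume "b_vertex C c w"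
            then have "b_vertex C (r a) w \<and> r a w = c w"
              using \<open>a \<in> M\<close> that \<open>b \<in> C\<close> E_commute[of y w] by (intro keeps) auto
            then show False
              using b that by (auto simp: K_def undominated_def)
          qed
          ultimately show "b \<in> M - U"
            by (auto simp: M_def)
        qed
        \<comment> \<open>A b-vertex \<open>v\<close> spoiled by both choices shares with
          \<open>y\<close> neighbours of the distinct colours \<open>a\<close> and
          \<open>a'\<close>, which closes a 4-cycle.\<close>
        have K_disj: "K a \<inter> K a' = {}" if a: "a \<in> M" "a' \<in> M" "a \<noteq> a'" for a a'
        proof (rule ccontr)
          assume "K a \<inter> K a' \<noteq> {}"
          then obtain b where b: "b \<in> K a" "b \<in> K a'"
            by blast
          then have "b \<in> C" "b \<notin> U"
            by (auto simp: K_def undominated_def)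
          then obtain v where v: "b_vertex C c v" "c v = b"
            by (auto simp: U_def undominated_def)
          obtain z z' where z: "E v z" "E y z" "c z = a" "E v z'" "E y z'" "c z' = a'"
            using spoiled[OF a(1) b(1) v] spoiled[OF a(2) b(2) v] by blast
          have "v \<noteq> y"
            using v \<open>b \<in> C\<close> y assms(3) by auto
          then have "z = z'"
            using C4_free[of v z y z'] z E_sym by blast
          then show False
            using z a(3) by simp
        qed
        have "U \<subseteq> M"
          using finU by (auto simp: U_def M_def undominated_def)
        then obtain a where a: "a \<in> M" "card ((U - {a}) \<union> K a) \<le> 1"
          using exists_single_defect[of M U K] K_M K_disj \<open>finite M\<close> False less.prems(2)
          unfolding U_def by blast
        \<comment> \<open>Colour \<open>a\<close> drops out because \<open>y\<close> now dominates
          it.\<close>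
        have "undominated C (r a) \<subseteq> (U - {a}) \<union> K a"
          using y_dom[OF a(1)] by (auto simp: K_def undominated_def)
        moreover have "finite ((U - {a}) \<union> K a)"
          using finU K_M[OF a(1)] \<open>finite M\<close> by (meson finite_Diff finite_UnI finite_subset)
        ultimately have "card (undominated C (r a)) \<le> 1"
          using a(2) card_mono le_trans by meson
        moreover have "card {v \<in> V. r a v = s} < card {v \<in> V. c v = s}"
        proof (rule decrease)
          show "r a y \<noteq> s"
            using a(1) \<open>M \<subseteq> C\<close> assms(3) by (auto simp: r_def)
          show "c v = s" if "r a v = s" for v
            using that a(1) l[of v] \<open>M \<subseteq> C\<close> y assms(3) by (auto simp: r_def split: if_splits)
        qed
        ultimately show ?thesis
          using less.hyps r_proper[OF a(1)] by blast
      qed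
    qed
  qed
qed

end

section \<open>Transfer to b-colourings and the b-chromatic number\<close>

lemma b_colouring_iff_b_col:
  assumes "finite_sym_rel (verts G) (\<lambda>u v. u \<rightarrow>\<^bsub>G\<^esub> v)"
  shows "b_colouring G k c \<longleftrightarrow> finite_sym_rel.b_col (verts G) (\<lambda>u v. u \<rightarrow>\<^bsub>G\<^esub> v) {..<k} c"
proof -
  interpret finite_sym_rel "verts G" "\<lambda>u v. u \<rightarrow>\<^bsub>G\<^esub> v"
    by fact
  have nbr: "(\<exists>w\<in>verts G. c w = j \<and> v \<rightarrow>\<^bsub>G\<^esub> w) \<longleftrightarrow> (\<exists>w. v \<rightarrow>\<^bsub>G\<^esub> w \<and> c w = j)" for v j
    using E_in_V by blast
  have "proper_colouring G k c \<longleftrightarrow> proper {..<k} c"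
    unfolding proper_colouring_def proper_def by blast
  moreover define D where "D v i \<longleftrightarrow> v \<in> verts G \<and> c v = i \<and>
      (\<forall>j<k. j \<noteq> i \<longrightarrow> (\<exists>w\<in>verts G. c w = j \<and> v \<rightarrow>\<^bsub>G\<^esub> w))" for v i
  have "b_vertex {..<k} c v \<and> c v = i \<longleftrightarrow> D v i" for v i
    unfolding D_def nbr b_vertex_def lessThan_iff Ball_def by metis
  then have "undominated {..<k} c = {} \<longleftrightarrow> (\<forall>i<k. \<exists>v. D v i)"
    unfolding undominated_def by auto
  ultimately show ?thesis
    unfolding b_colouring_def b_col_def D_def Bex_def by simp
qed

text \<open>A bijection \<open>h\<close> from \<open>C\<close> to an initial segment renumbers the
  colours and preserves b-vertices.\<close>

lemma b_colouring_card_of_b_col: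
  assumes "finite_sym_rel (verts G) (\<lambda>u v. u \<rightarrow>\<^bsub>G\<^esub> v)"
    and "finite_sym_rel.b_col (verts G) (\<lambda>u v. u \<rightarrow>\<^bsub>G\<^esub> v) C c"
  shows "\<exists>c'. b_colouring G (card C) c'"
proof -
  interpret finite_sym_rel "verts G" "\<lambda>u v. u \<rightarrow>\<^bsub>G\<^esub> v"
    by fact
  have "finite C"
    using assms(2) by (simp add: b_col_def)
  then obtain h where h: "bij_betw h C {..<card C}"
    using ex_bij_betw_finite_nat atLeast0LessThan by metis
  have cC: "c v \<in> C" if "v \<in> verts G" for v
    using assms(2) that by (auto simp: b_col_def proper_def)
  have inj: "h i = h j \<longleftrightarrow> i = j" if "i \<in> C" "j \<in> C" for i j
    using h that by (auto simp: bij_betw_def inj_on_def)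
  have "proper {..<card C} (h \<circ> c)"
    using assms(2) cC inj h E_in_V unfolding b_col_def proper_def bij_betw_def
    by (auto simp: image_subset_iff; blast)
  moreover have "\<exists>v. b_vertex {..<card C} (h \<circ> c) v \<and> (h \<circ> c) v = i" if i: "i < card C" for i
  proof -
    have "i \<in> h ` C"
      using h i by (simp add: bij_betw_def)
    then obtain i' where i': "i' \<in> C" "h i' = i"
      by blast
    then obtain v where v: "b_vertex C c v" "c v = i'"
      using assms(2) by (auto simp: b_col_def undominated_def)
    have "\<exists>w. v \<rightarrow>\<^bsub>G\<^esub> w \<and> h (c w) = j" if "j < card C" "j \<noteq> i" for j
    proof -
      have "j \<in> h ` C"
        using h that by (simp add: bij_betw_def)
      then obtain j' where j': "j' \<in> C" "h j' = j"
        by blast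
      then have "j' \<noteq> c v"
        using that i' v by auto
      then show ?thesis
        using v(1) j' unfolding b_vertex_def by blast
    qed
    then show ?thesis
      using v i' by (intro exI[of _ v]) (auto simp: b_vertex_def)
  qed
  ultimately have "b_col {..<card C} (h \<circ> c)"
    by (auto simp: b_col_def undominated_def)
  then show ?thesis
    using b_colouring_iff_b_col[OF assms(1)] by blast
qed

text \<open>Every colour below \<open>k\<close> occurs. The bound ensures that the
  \<open>GREATEST\<close> in \<open>b_chromatic_number\<close> is attained.\<close>

lemma b_colouring_le_card:
  assumes "finite (verts G)" "b_colouring G k c"
  shows "k \<le> card (verts G)"
proof -
  have "{..<k} \<subseteq> c ` verts G"
    using assms(2) by (fastforce simp: b_colouring_def)
  then show ?thesis
    using surj_card_le[OF assms(1)] by fastforce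
qed

lemma b_colouring_le_b_chromatic_number:
  assumes "finite (verts G)" "b_colouring G k c"
  shows "k \<le> b_chromatic_number G"
  unfolding b_chromatic_number_def
  using assms(2) b_colouring_le_card[OF assms(1)]
  by (intro Greatest_le_nat[where P = "\<lambda>k. \<exists>c. b_colouring G k c" and b = "card (verts G)"]) auto

lemma b_colouring_b_chromatic_number:
  assumes "finite (verts G)" "b_colouring G k c"
  shows "\<exists>c. b_colouring G (b_chromatic_number G) c"
  unfolding b_chromatic_number_def
  using assms(2) b_colouring_le_card[OF assms(1)]
  by (intro GreatestI_nat[where P = "\<lambda>k. \<exists>c. b_colouring G k c" and b = "card (verts G)"]) auto

lemma dominates_del_vert:
  "u \<rightarrow>\<^bsub>pre_digraph.del_vert G x\<^esub> v \<longleftrightarrow> u \<rightarrow>\<^bsub>G\<^esub> v \<and> u \<noteq> x \<and> v \<noteq> x"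
  unfolding arcs_ends_conv pre_digraph.del_vert_def by auto

section \<open>Girth and 4-cycles\<close>

lemma no_4_cycle:
  assumes "graph G" "girth G \<ge> 5"
    and "u \<rightarrow>\<^bsub>G\<^esub> v" "v \<rightarrow>\<^bsub>G\<^esub> w" "w \<rightarrow>\<^bsub>G\<^esub> y" "y \<rightarrow>\<^bsub>G\<^esub> u" "u \<noteq> w"
  shows "v = y"
proof (rule ccontr)
  assume "v \<noteq> y"
  interpret graph G
    by fact
  obtain e1 e2 e3 e4 where e: "{e1, e2, e3, e4} \<subseteq> arcs G"
    "tail G e1 = u" "head G e1 = v" "tail G e2 = v" "head G e2 = w"
    "tail G e3 = w" "head G e3 = y" "tail G e4 = y" "head G e4 = u"
    using assms(3-6) by (auto simp: arcs_ends_conv)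
  have ne: "u \<noteq> v" "v \<noteq> w" "w \<noteq> y" "y \<noteq> u"
    using e no_loops by fastforce+
  \<comment> \<open>Adjacent vertices differ as there are no loops; the two diagonal pairs differ by
    assumption.\<close>
  have "cycle [e1, e2, e3, e4]"
    unfolding cycle_def awalk_def
    using e ne assms(7) \<open>v \<noteq> y\<close> tail_in_verts[of e1] by (intro exI[of _ u]) auto
  then have "girth G \<le> enat (length [e1, e2, e3, e4])"
    unfolding girth_def by (intro Inf_lower) (auto intro!: exI[of _ "[e1, e2, e3, e4]"])
  also have "\<dots> < 5"
    by (simp add: numeral_eq_enat)
  finally show False
    using assms(2) by simp
qed

section \<open>Deleting a vertex\<close>

theorem theorem6:
  fixes G :: "('a, 'b) pre_digraph"
  assumes "graph G"
    and "girth G \<ge> 5"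
    and "x \<in> verts G"
  shows "int (b_chromatic_number (pre_digraph.del_vert G x)) \<ge> int (b_chromatic_number G) - 2"
proof -
  interpret graph G
    by fact
  let ?E = "\<lambda>u v. u \<rightarrow>\<^bsub>G\<^esub> v"
  define H where "H = del_vert x"
  let ?F = "\<lambda>u v. u \<rightarrow>\<^bsub>H\<^esub> v"
  have vH: "verts H = verts G - {x}"
    by (simp add: H_def verts_del_vert)
  have FE: "?F u v \<longleftrightarrow> ?E u v \<and> u \<noteq> x \<and> v \<noteq> x" for u v
    by (simp add: H_def dominates_del_vert)
  have relG: "finite_sym_rel (verts G) ?E"
    proof
    show "v \<rightarrow>\<^bsub>G\<^esub> u" if "u \<rightarrow>\<^bsub>G\<^esub> v" for u v
      using sym_arcs that by (rule arcs_ends_symmetric)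
  qed (auto simp: arcs_ends_conv dest: no_loops)
  then interpret G: finite_sym_rel "verts G" ?E .
  have relH: "finite_sym_rel (verts H) ?F"
  proof
    show "v \<rightarrow>\<^bsub>H\<^esub> u" if "u \<rightarrow>\<^bsub>H\<^esub> v" for u v
      using that G.E_sym[of u v] by (simp add: FE)
  qed (use G.E_in_V G.E_irrefl in \<open>auto simp: vH FE\<close>)
  then interpret H: finite_sym_rel "verts H" ?F .
  define k where "k = b_chromatic_number G"
  obtain C0 c0 where "G.b_col C0 c0"
    using G.b_col_exists by blast
  then obtain c where "b_colouring G k c"
    using b_colouring_card_of_b_col[OF relG] b_colouring_b_chromatic_number[of G] k_def
    by fastforce
  then have c: "G.b_col {..<k} c"
    using b_colouring_iff_b_col[OF relG] by blast
  \<comment> \<open>Deleting \<open>x\<close> removes only the colour \<open>c x\<close> from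
    neighbourhoods, so \<open>c x\<close> is taken as the special colour.\<close>
  define C where "C = {..<k} - {c x}"
  have "c x < k"
    using c assms(3) by (auto simp: G.b_col_def G.proper_def)
  then have cardC: "card C = k - 1"
    by (simp add: C_def)
  have pr: "H.proper (insert (c x) C) c"
  proof -
    have "c ` verts G \<subseteq> {..<k}" "\<And>u v. ?E u v \<Longrightarrow> c u \<noteq> c v"
      using c by (simp_all add: G.b_col_def G.proper_def)
    then show ?thesis
      unfolding H.proper_def by (auto simp: C_def FE vH)
  qed
  \<comment> \<open>Neither the old b-vertex nor its needed neighbours can be \<open>x\<close>, as
    their colours lie in \<open>C\<close>.\<close>
  have "\<exists>v. H.b_vertex C c v \<and> c v = i" if "i \<in> C" for i
  proof -
    obtain v where v: "G.b_vertex {..<k} c v" "c v = i"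
      using c \<open>i \<in> C\<close> by (auto simp: G.b_col_def G.undominated_def C_def)
    then have "v \<noteq> x" "v \<in> verts G"
      using \<open>i \<in> C\<close> by (auto simp: C_def G.b_vertex_def)
    moreover have "\<exists>w. ?F v w \<and> c w = j" if j: "j \<in> C" "j \<noteq> c v" for j
    proof -
      obtain w where "?E v w" "c w = j"
        using v(1) j unfolding G.b_vertex_def C_def by blast
      moreover have "w \<noteq> x"
        using calculation j by (auto simp: C_def)
      ultimately show ?thesis
        using \<open>v \<noteq> x\<close> FE by blast
    qed
    ultimately have "H.b_vertex C c v"
      unfolding H.b_vertex_def by (simp add: vH)
    then show ?thesis
      using v by blast
  qed
  then have "H.undominated C c = {}"
    by (auto simp: H.undominated_def)
  then have "card (H.undominated C c) \<le> 1"
    by simp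
  moreover have "v = y" if "?F u v" "?F v w" "?F w y" "?F y u" "u \<noteq> w" for u v w y
    using that unfolding FE by (intro no_4_cycle[OF assms(1,2), of u v w y]) simp_all
  moreover have "finite C" "c x \<notin> C"
    by (simp_all add: C_def)
  \<comment> \<open>One colour went with \<open>c x\<close>, and at most one more is lost here,
    which gives the 2 of the claim.\<close>
  ultimately obtain C' c' where C': "H.b_col C' c'" "card C \<le> card C' + 1"
    using H.b_col_of_special_class[of C "c x" c] pr by metis
  then have "card C' \<le> b_chromatic_number H"
    using b_colouring_card_of_b_col[OF relH C'(1)] b_colouring_le_b_chromatic_number[OF H.finite_V]
    by auto
  then show ?thesis
    using C'(2) cardC by (simp add: H_def k_def)
qed

end
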